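(* Let $u:\mathbb{R}^m\to\mathbb{R}^m$, $u(y_1)=K_{11}y_1+g_1(y_1)$, and $v:\mathbb{R}^{m+n}\to\mathbb{R}^{n}$, $v(y_1,y_2)=K_{22}y_2+g_2(y_1,y_2)$, where $y_1\in\mathbb{R}^m$, $y_2\in\mathbb{R}^n$. Consider an $s$-stage SSEI method which, when applied to $y_1'=u(y_1)$ (with linear part $K_{11}$ and nonlinearity $g_1$), is volume preserving. Assume that there exists an invertible matrix $P$ such that for all $y_1,y_2$, $$P\,\partial_{y_2}v(y_1,y_2)P^{-1}=-\partial_{y_2}v(y_1,y_2)^{\intercal},\qquad P\,\partial_{y_2}g_2(y_1,y_2)P^{-1}=-\partial_{y_2}g_2(y_1,y_2)^{\intercal}.$$ Then the SSEI method is volume preserving for the vector fields $f(y_1,y_2)=(u(y_1),v(y_1,y_2))^{\intercal}$ in $\mathcal F^{(\infty)}$ (applied to $y'=f(y)=Ky+g(y)$ with $K=\mathrm{diag}(K_{11},K_{22})$ and $g(y)=(g_1(y_1),g_2(y_1,y_2))^{\intercal}$).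
   Context: $|\cdot|$ denotes the determinant. For an ODE $y'=Ky+g(y)=:f(y)$ on $\mathbb{R}^d$ ($K$ a real $d\times d$ matrix with $|e^{hK}|\ne-1$ for $0<h<1$, $g$ differentiable, $f$ divergence free), an $s$-stage SSEI (special symplectic exponential integrator) method with stepsize $h$ is the map $$\varphi_h(y)=e^{hK}y+h\sum_{i=1}^{s}b_ie^{(1-c_i)hK}g(k_i(y)),\qquad k_i(y)=e^{c_ihK}y+h\sum_{j=1}^{s}a_{ij}e^{(c_i-c_j)hK}g(k_j(y)),\quad i=1,\dots,s,$$ where $c=(c_i)$, $b=(b_i)$, $A=(a_{ij})$ are the coefficients of an $s$-stage Runge--Kutta method which is symplectic ($b_ia_{ij}+b_ja_{ji}-b_ib_j=0$ for all $i,j$) and satisfies $b_j\neq0$ for all $j$. It is understood that the stage equations define $k_1,\dots,k_s$ as differentiable functions of $y$ and that the block matrix with blocks $\delta_{ij}I-h\,a_{ij}e^{(c_i-c_j)hK}g'(k_j)$ is invertible. The method is volume preserving if $|\varphi_h'(y)|=1$ for all $y$. Classes of vector fields: $\mathcal H$ is the set of $f$ for which there exists an invertible matrix $P$ with $Pf'(y)P^{-1}=-f'(y)^{\intercal}$ for all $y$. $\mathcal F^{(\infty)}$ is defined recursively as the set of vector fields $f(y_1,y_2)=(u(y_1),v(y_1,y_2))^{\intercal}$ with $u\in\mathcal H\cup\mathcal F^{(\infty)}$ for which there exists an invertible $P$ such that $P\,\partial_{y_2}v(y_1,y_2)P^{-1}=-\partial_{y_2}v(y_1,y_2)^{\intercal}$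 for all $y_1,y_2$. *)

theory Defs
  imports "HOL-Analysis.Analysis"
begin

text \<open>The library function exp needs a Banach algebra, which the type of square matrices is not;
  hence the exponential series is written out, with powers with respect to the matrix product.\<close>

definition mat_exp :: "real^'d^'d \<Rightarrow> real^'d^'d" where
  "mat_exp M = (\<Sum>k. (1 / fact k) *\<^sub>R (((**) M ^^ k) (mat 1)))"

text \<open>Coordinates of \<open>\<real>\<^sup>m\<^sup>+\<^sup>n\<close> are indexed by the sum type \<open>'m + 'n\<close>.\<close>

definition stack :: "real^'m \<Rightarrow> real^'n \<Rightarrow> real^('m + 'n)" where
  "stack y1 y2 = (\<chi> i. case i of Inl p \<Rightarrow> y1 $ p | Inr q \<Rightarrow> y2 $ q)"

definition block_diag :: "real^'m^'m \<Rightarrow> real^'n^'n \<Rightarrow> real^('m + 'n)^('m + 'n)" where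
  "block_diag M N = (\<chi> i j. case (i, j) of
      (Inl p, Inl q) \<Rightarrow> M $ p $ q
    | (Inr p, Inr q) \<Rightarrow> N $ p $ q
    | _ \<Rightarrow> 0)"

definition symplectic_RK :: "real^'s \<Rightarrow> real^'s^'s \<Rightarrow> bool" where
  "symplectic_RK b a \<longleftrightarrow> (\<forall>i j. b$i * a$i$j + b$j * a$j$i - b$i * b$j = 0)"

definition divergence_free :: "(real^'d \<Rightarrow> real^'d) \<Rightarrow> bool" where
  "divergence_free f \<longleftrightarrow> (\<forall>y. trace (jacobian f (at y)) = 0)"

definition ssei_stage_matrix ::
  "real^'s \<Rightarrow> real^'s^'s \<Rightarrow> real \<Rightarrow> real^'d^'d \<Rightarrow> (real^'d \<Rightarrow> real^'d) \<Rightarrow> ('s \<Rightarrow> real^'d)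
    \<Rightarrow> real^('s \<times> 'd)^('s \<times> 'd)" where
  "ssei_stage_matrix c a h K g x = (\<chi> p q.
     ((if fst p = fst q then mat 1 else 0)
       - (h * a $ fst p $ fst q) *\<^sub>R
           (mat_exp (((c $ fst p - c $ fst q) * h) *\<^sub>R K) ** jacobian g (at (x (fst q)))))
     $ snd p $ snd q)"

text \<open>The stage equations are implicit: \<open>k\<close> is a choice of stage functions that solve them,
  are differentiable, and make the matrix of the differentiated stage equations invertible.\<close>

definition ssei_stages ::
  "real^'s \<Rightarrow> real^'s^'s \<Rightarrow> real \<Rightarrow> real^'d^'d \<Rightarrow> (real^'d \<Rightarrow> real^'d)
    \<Rightarrow> ('s \<Rightarrow> real^'d \<Rightarrow> real^'d) \<Rightarrow> bool" where
  "ssei_stages c a h K g k \<longleftrightarrow>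
     (\<forall>i y. k i y = mat_exp ((c$i * h) *\<^sub>R K) *v y
        + h *\<^sub>R (\<Sum>j\<in>UNIV. a$i$j *\<^sub>R (mat_exp (((c$i - c$j) * h) *\<^sub>R K) *v g (k j y))))
   \<and> (\<forall>i y. k i differentiable (at y))
   \<and> (\<forall>y. invertible (ssei_stage_matrix c a h K g (\<lambda>i. k i y)))"

definition ssei_map ::
  "real^'s \<Rightarrow> real^'s \<Rightarrow> real^'s^'s \<Rightarrow> real \<Rightarrow> real^'d^'d \<Rightarrow> (real^'d \<Rightarrow> real^'d)
    \<Rightarrow> (real^'d \<Rightarrow> real^'d) \<Rightarrow> bool" where
  "ssei_map c b a h K g \<phi> \<longleftrightarrow> (\<exists>k. ssei_stages c a h K g k \<and>
     (\<forall>y. \<phi> y = mat_exp (h *\<^sub>R K) *v y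
        + h *\<^sub>R (\<Sum>i\<in>UNIV. b$i *\<^sub>R (mat_exp (((1 - c$i) * h) *\<^sub>R K) *v g (k i y)))))"

text \<open>Standing assumptions for applying the method to \<open>y' = K y + g y\<close>.  As \<open>det\<close> is the
  determinant, the first condition always holds; it is kept since it is part of the setting.\<close>

definition ssei_applicable ::
  "real^'s \<Rightarrow> real^'s \<Rightarrow> real^'s^'s \<Rightarrow> real \<Rightarrow> real^'d^'d \<Rightarrow> (real^'d \<Rightarrow> real^'d) \<Rightarrow> bool" where
  "ssei_applicable c b a h K g \<longleftrightarrow>
     (\<forall>t. 0 < t \<and> t < 1 \<longrightarrow> det (mat_exp (t *\<^sub>R K)) \<noteq> -1)
   \<and> (\<forall>y. g differentiable (at y))
   \<and> divergence_free (\<lambda>y. K *v y + g y)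
   \<and> (\<exists>\<phi>. ssei_map c b a h K g \<phi>)"

text \<open>The quantifier over \<open>\<phi>\<close> only matters if the stage equations have several admissible
  solutions; if they determine the stages, it ranges over a single map.\<close>

definition ssei_volume_preserving ::
  "real^'s \<Rightarrow> real^'s \<Rightarrow> real^'s^'s \<Rightarrow> real \<Rightarrow> real^'d^'d \<Rightarrow> (real^'d \<Rightarrow> real^'d) \<Rightarrow> bool" where
  "ssei_volume_preserving c b a h K g \<longleftrightarrow>
     (\<forall>\<phi>. ssei_map c b a h K g \<phi> \<longrightarrow> (\<forall>y. det (jacobian \<phi> (at y)) = 1))"

text \<open>The recursion defining \<open>\<F>\<^sup>\<infinity>\<close> runs through vector fields of different
  dimensions, i.e. of different types.  It is therefore carried out inside \<open>\<real>\<^sup>d\<close>: the vector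
  field \<open>u\<close> on a smaller space is the part of \<open>f\<close> with indices in a set \<open>I\<close>, which has to
  depend on the coordinates in \<open>I\<close> only.  The Jacobian of \<open>u\<close> is then the diagonal
  block of \<open>f'\<close> with indices in \<open>I\<close>, and the partial Jacobian of \<open>v\<close> is the diagonal block with
  indices in the set \<open>J\<close> of the new coordinates.  As the coordinates are not ordered, \<open>I\<close> and \<open>J\<close>
  are arbitrary disjoint index sets.\<close>

definition closed_subsystem :: "(real^'d \<Rightarrow> real^'d) \<Rightarrow> 'd set \<Rightarrow> bool" where
  "closed_subsystem f I \<longleftrightarrow>
     (\<forall>y z. (\<forall>i\<in>I. y$i = z$i) \<longrightarrow> (\<forall>i\<in>I. f y $ i = f z $ i))"

definition diag_block :: "'d set \<Rightarrow> real^'d^'d \<Rightarrow> real^'d^'d" where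
  "diag_block J M = (\<chi> i j. if i \<in> J \<and> j \<in> J then M$i$j else 0)"

text \<open>A matrix \<open>P\<close> indexed by \<open>J\<close> is represented by its extension by the identity, a block with
  indices in \<open>J\<close> by its extension by zero.  Invertibility of \<open>P\<close> and the equation below hold for the
  extensions iff they hold for the blocks themselves.\<close>

definition skew_similar_block :: "(real^'d \<Rightarrow> real^'d) \<Rightarrow> 'd set \<Rightarrow> bool" where
  "skew_similar_block f J \<longleftrightarrow> (\<exists>P. invertible P
     \<and> (\<forall>i j. \<not> (i \<in> J \<and> j \<in> J) \<longrightarrow> P$i$j = mat 1 $ i $ j)
     \<and> (\<forall>y. P ** diag_block J (jacobian f (at y)) ** matrix_inv P
             = - transpose (diag_block J (jacobian f (at y)))))"

definition class_H_on :: "(real^'d \<Rightarrow> real^'d) \<Rightarrow> 'd set \<Rightarrow> bool" where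
  "class_H_on f I \<longleftrightarrow> closed_subsystem f I \<and> skew_similar_block f I"

inductive class_F_inf_on :: "(real^'d \<Rightarrow> real^'d) \<Rightarrow> 'd set \<Rightarrow> bool" for f where
  "class_H_on f I \<or> class_F_inf_on f I \<Longrightarrow> I \<noteq> {} \<Longrightarrow> J \<noteq> {} \<Longrightarrow> I \<inter> J = {}
    \<Longrightarrow> closed_subsystem f (I \<union> J) \<Longrightarrow> skew_similar_block f J
    \<Longrightarrow> class_F_inf_on f (I \<union> J)"

definition class_H :: "(real^'d \<Rightarrow> real^'d) set" where
  "class_H = {f. (\<forall>y. f differentiable (at y)) \<and> class_H_on f UNIV}"

definition class_F_inf :: "(real^'d \<Rightarrow> real^'d) set" where
  "class_F_inf = {f. (\<forall>y. f differentiable (at y)) \<and> class_F_inf_on f UNIV}"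

lemma class_H_iff:
  fixes f :: "real^'d \<Rightarrow> real^'d"
  shows "f \<in> class_H \<longleftrightarrow> (\<forall>y. f differentiable (at y)) \<and>
     (\<exists>P. invertible P \<and> (\<forall>y. P ** jacobian f (at y) ** matrix_inv P = - transpose (jacobian f (at y))))"
proof -
  have "closed_subsystem f UNIV"
    unfolding closed_subsystem_def by (metis UNIV_I vec_eq_iff)
  moreover have "diag_block UNIV M = M" for M :: "real^'d^'d"
    by (simp add: diag_block_def)
  ultimately show ?thesis
    by (simp add: class_H_def class_H_on_def skew_similar_block_def)
qed

end

theory Submission
  imports Defs
begin

text \<open>
  In the coordinates \<open>(y1, y2)\<close> the derivative of the numerical map is block lower triangular, and
  its determinant is the product of the determinants of the two diagonal blocks.  That the upper
  right block vanishes is not automatic, since the stages are only implicitly defined functions of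
  \<open>(y1, y2)\<close>.  It follows from the differentiated stage equations: the derivatives of the upper stage
  components with respect to \<open>y2\<close> solve a homogeneous linear system, whose matrix is a diagonal block
  of the invertible, block triangular stage matrix, so they are zero.

  The upper left block is the derivative of the method applied to \<open>u\<close>: for a fixed \<open>y2\<close> the upper
  components of the stages are admissible stages for \<open>(K11, g1)\<close>
  (\<open>ssei_map_upper_part\<close>), and the method is volume preserving there by hypothesis.

  The lower right block \<open>D\<close> is what the method produces from the variational equation in \<open>y2\<close>,
  in which \<open>K22\<close> and all matrices \<open>G\<^sub>j = \<partial>g2/\<partial>y2\<close> at the stages satisfy \<open>P A = - A\<^sup>T P\<close>.
  Two facts give \<open>det D = 1\<close> (\<open>det_symplectic_RK_eq_1\<close>).  A bordered determinant
  (\<open>det_bordered\<close>) shows that \<open>det D\<close> is \<open>det (exp (h K22))\<close> times the quotient of the determinants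
  of two stage matrices, one with the coefficients \<open>a\<^sub>i\<^sub>j - b\<^sub>j\<close> and one with \<open>a\<^sub>i\<^sub>j\<close>.  By
  symplecticity \<open>a\<^sub>i\<^sub>j - b\<^sub>j = - b\<^sub>j a\<^sub>j\<^sub>i / b\<^sub>i\<close>, so that a diagonal scaling, a transposition, the
  conjugation by \<open>P\<close> and the identity \<open>det (1 + U V) = det (1 + V U)\<close> turn the first stage
  matrix into the second.  Finally \<open>exp (t K22)\<close> leaves the bilinear form \<open>P\<close> invariant, hence has
  determinant 1 or -1, and as a square it has determinant 1.

  The route through stage matrices determines \<open>det D\<close> itself; the invariance of the form \<open>P\<close>
  under \<open>D\<close> would only determine its square.
\<close>

section \<open>Matrix algebra\<close>

lemma matrix_add_rdistrib: "(A + B) ** C = A ** C + B ** C" for A B :: "real^'n^'m" and C :: "real^'p^'n"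
  by (simp add: matrix_matrix_mult_def vec_eq_iff sum.distrib distrib_right)

lemma matrix_diff_rdistrib: "(A - B) ** C = A ** C - B ** C" for A B :: "real^'n^'m" and C :: "real^'p^'n"
  by (simp add: matrix_matrix_mult_def vec_eq_iff sum_subtractf left_diff_distrib)

lemma matrix_diff_ldistrib: "A ** (B - C) = A ** B - A ** C" for A :: "real^'n^'m" and B C :: "real^'p^'n"
  by (simp add: matrix_matrix_mult_def vec_eq_iff sum_subtractf right_diff_distrib)

lemma minus_matrix_mult: "(- A) ** B = - (A ** B)" for A :: "real^'n^'m" and B :: "real^'p^'n"
  by (simp add: matrix_matrix_mult_def vec_eq_iff sum_negf)

lemma matrix_mult_minus: "A ** (- B) = - (A ** B)" for A :: "real^'n^'m" and B :: "real^'p^'n"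
  by (simp add: matrix_matrix_mult_def vec_eq_iff sum_negf)

lemma matrix_mult_scaleR: "A ** (r *\<^sub>R B) = r *\<^sub>R (A ** B)" "(r *\<^sub>R A) ** B = r *\<^sub>R (A ** B)"
  for A :: "real^'n^'m" and B :: "real^'p^'n"
  by (simp_all add: matrix_scalar_ac scalar_matrix_assoc)

lemma matrix_sum_vector_mult: "(\<Sum>j\<in>I. M j) *v v = (\<Sum>j\<in>I. M j *v v)" for M :: "'i \<Rightarrow> real^'n^'m"
  by (induction I rule: infinite_finite_induct) (simp_all add: matrix_vector_mult_add_rdistrib)

lemma transpose_add: "transpose (A + B) = transpose A + transpose B"
  by (simp add: vec_eq_iff transpose_def)

lemma transpose_0 [simp]: "transpose 0 = 0"
  by (simp add: vec_eq_iff transpose_def)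

section \<open>Determinants of block triangular and bordered matrices\<close>

text \<open>In the Leibniz expansion a permutation contributes only if it fixes every index of an identity
  row.  Such permutations are the extensions of the permutations of the remaining indices, with the
  same sign.  Using an injection \<open>e\<close> for these indices covers both diagonal blocks of a block matrix.\<close>

lemma det_identity_rows:
  fixes M :: "real^'k^'k" and e :: "'m::finite \<Rightarrow> 'k"
  assumes inj: "inj e" and rows: "\<And>x. x \<notin> range e \<Longrightarrow> M $ x = mat 1 $ x"
  shows "det M = det (\<chi> i j. M $ e i $ e j)"
proof -
  let ?R = "range e"
  let ?t = "\<lambda>p. of_int (sign p) * (\<Prod>x\<in>UNIV. M $ x $ p x)"
  let ?ext = "map_permutation UNIV e"
  have bij: "bij_betw e UNIV ?R"
    using inj by (simp add: bij_betw_def)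
  have "det M = (\<Sum>p | p permutes UNIV. ?t p)"
    by (simp add: det_def)
  also have "\<dots> = (\<Sum>p | p permutes ?R. ?t p)"
  proof (rule sum.mono_neutral_right)
    show "finite {p. p permutes (UNIV :: 'k set)}"
      by (simp add: finite_permutations)
    show "{p. p permutes ?R} \<subseteq> {p. p permutes UNIV}"
      using permutes_subset by blast
    show "\<forall>p \<in> {p. p permutes UNIV} - {p. p permutes ?R}. ?t p = 0"
    proof
      fix p assume p: "p \<in> {p. p permutes (UNIV :: 'k set)} - {p. p permutes ?R}"
      then obtain x where x: "x \<notin> ?R" "p x \<noteq> x"
        using permutes_superset[of p UNIV ?R] by blast
      then have "M $ x $ p x = 0"
        using rows by (simp add: mat_def)
      then show "?t p = 0"
        by auto
    qed
  qed
  also have "\<dots> = (\<Sum>p | p permutes UNIV. ?t (?ext p))"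
  proof (rule sum.reindex_bij_witness[where i = ?ext and j = "map_permutation ?R (inv_into UNIV e)"])
    fix p assume "p \<in> {p. p permutes ?R}"
    then have p: "p permutes ?R" by simp
    show "?ext (map_permutation ?R (inv_into UNIV e) p) = p"
      by (rule map_permutation_compose_inv[OF bij_betw_inv_into[OF bij] p]) (simp add: f_inv_into_f)
    then show "?t (?ext (map_permutation ?R (inv_into UNIV e) p)) = ?t p"
      by simp
    show "map_permutation ?R (inv_into UNIV e) p \<in> {p. p permutes UNIV}"
      using map_permutation_permutes[OF bij_betw_inv_into[OF bij] p] by simp
  next
    fix p assume "p \<in> {p. p permutes (UNIV :: 'm set)}"
    then have p: "p permutes (UNIV :: 'm set)" by simp
    show "map_permutation ?R (inv_into UNIV e) (?ext p) = p"
      by (rule map_permutation_compose_inv[OF bij p]) (simp add: inj)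
    show "?ext p \<in> {p. p permutes ?R}"
      using map_permutation_permutes[OF bij p] by simp
  qed
  also have "\<dots> = (\<Sum>p | p permutes UNIV. of_int (sign p) * (\<Prod>i\<in>UNIV. M $ e i $ e (p i)))"
  proof (rule sum.cong[OF refl])
    fix p assume "p \<in> {p. p permutes (UNIV :: 'm set)}"
    then have p: "p permutes (UNIV :: 'm set)" by simp
    have "(\<Prod>x\<in>UNIV. M $ x $ ?ext p x) = (\<Prod>x\<in>?R. M $ x $ ?ext p x)"
    proof (rule prod.mono_neutral_right)
      show "\<forall>x\<in>UNIV - ?R. M $ x $ ?ext p x = 1"
        using rows map_permutation_permutes[OF bij p] by (simp add: mat_def permutes_not_in)
    qed auto
    also have "\<dots> = (\<Prod>i\<in>UNIV. M $ e i $ e (p i))"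
      using inj by (simp add: prod.reindex map_permutation_apply)
    finally show "?t (?ext p) = of_int (sign p) * (\<Prod>i\<in>UNIV. M $ e i $ e (p i))"
      using sign_map_permutation[of e UNIV p] inj p by simp
  qed
  also have "\<dots> = det (\<chi> i j. M $ e i $ e j)"
    by (simp add: det_def)
  finally show ?thesis .
qed

definition from_blocks ::
  "real^'m^'p \<Rightarrow> real^'n^'p \<Rightarrow> real^'m^'q \<Rightarrow> real^'n^'q \<Rightarrow> real^('m + 'n)^('p + 'q)" where
  "from_blocks A B C D = (\<chi> i. case i of Inl p \<Rightarrow> stack (A $ p) (B $ p) | Inr q \<Rightarrow> stack (C $ q) (D $ q))"

lemma stack_nth [simp]:
  "stack x y $ Inl i = x $ i"
  "stack x y $ Inr j = y $ j"
  by (simp_all add: stack_def)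

lemma from_blocks_nth [simp]:
  "from_blocks A B C D $ Inl i = stack (A $ i) (B $ i)"
  "from_blocks A B C D $ Inr j = stack (C $ j) (D $ j)"
  by (simp_all add: from_blocks_def)

lemma vec_sum_eq_iff:
  fixes x y :: "'a^('m::finite + 'n::finite)"
  shows "x = y \<longleftrightarrow> (\<forall>i. x $ Inl i = y $ Inl i) \<and> (\<forall>j. x $ Inr j = y $ Inr j)"
  by (auto simp: vec_eq_iff) (metis sum.exhaust)

lemma sum_UNIV_Plus:
  "(\<Sum>i\<in>UNIV. f i) = (\<Sum>i\<in>UNIV. f (Inl i)) + (\<Sum>j\<in>UNIV. f (Inr j))"
  for f :: "'m::finite + 'n::finite \<Rightarrow> real"
  using sum.Plus[of "UNIV :: 'm set" "UNIV :: 'n set" f] by simp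

lemma from_blocks_mult:
  "from_blocks A B C D ** from_blocks A' B' C' D'
     = from_blocks (A ** A' + B ** C') (A ** B' + B ** D') (C ** A' + D ** C') (C ** B' + D ** D')"
  by (simp add: vec_sum_eq_iff vec_eq_iff matrix_matrix_mult_def sum_UNIV_Plus)

lemma block_diag_eq_from_blocks: "block_diag M N = from_blocks M 0 0 N"
  by (simp add: vec_sum_eq_iff vec_eq_iff block_diag_def)

lemma det_from_blocks_lower_triangular:
  fixes A :: "real^'m::finite^'m" and D :: "real^'n::finite^'n"
  shows "det (from_blocks A 0 C D) = det A * det D"
proof -
  have mat_1: "(mat 1 :: real^('m::finite + 'n::finite)^('m + 'n)) $ Inl i = stack (mat 1 $ i) 0"
    "(mat 1 :: real^('m::finite + 'n::finite)^('m + 'n)) $ Inr j = stack 0 (mat 1 $ j)" for i j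
    by (simp_all add: vec_sum_eq_iff mat_def)
  \<comment> \<open>Each of the two factors of the block triangular matrix has identity rows in one half of the
    coordinates.\<close>
  have "from_blocks A 0 0 (mat 1 :: real^'n^'n) $ x = mat 1 $ x" if "x \<notin> range Inl" for x
    using that by (cases x) (auto simp: mat_1)
  then have "det (from_blocks A 0 0 (mat 1 :: real^'n^'n)) = det A"
    by (subst det_identity_rows[where e = Inl]) (auto simp: vec_lambda_eta)
  moreover have "from_blocks (mat 1 :: real^'m^'m) 0 C D $ x = mat 1 $ x" if "x \<notin> range Inr" for x
    using that by (cases x) (auto simp: mat_1)
  then have "det (from_blocks (mat 1 :: real^'m^'m) 0 C D) = det D"
    by (subst det_identity_rows[where e = Inr]) (auto simp: vec_lambda_eta)
  moreover have "from_blocks A 0 C D = from_blocks A 0 0 (mat 1 :: real^'n^'n) ** from_blocks (mat 1 :: real^'m^'m) 0 C D"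
    by (simp add: from_blocks_mult)
  ultimately show ?thesis
    by (simp add: det_mul)
qed

lemma transpose_from_blocks:
  "transpose (from_blocks A B C D) = from_blocks (transpose A) (transpose C) (transpose B) (transpose D)"
  by (simp add: vec_sum_eq_iff vec_eq_iff transpose_def)

lemma det_from_blocks_upper_triangular:
  "det (from_blocks A B 0 D) = det A * det D"
  using det_from_blocks_lower_triangular[of "transpose A" "transpose B" "transpose D"]
    det_transpose[of "from_blocks A B 0 D"]
  by (simp add: transpose_from_blocks)

text \<open>The matrix with the rows \<open>(S, \<eta>)\<close> and \<open>(- \<beta>, E)\<close> can be factored into block triangular
  matrices in two ways, by eliminating with \<open>S\<close> or with \<open>E\<close>.  If \<open>X\<close> collects the stages of a
  one-step method for a linear equation, \<open>E + \<beta> X\<close> is the propagation matrix of a step.\<close>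

lemma det_bordered:
  fixes S :: "real^'k^'k" and E :: "real^'n^'n" and X \<eta> :: "real^'n^'k" and \<beta> :: "real^'k^'n"
  assumes X: "S ** X = \<eta>" and F: "F ** E = mat 1"
  shows "det S * det (E + \<beta> ** X) = det E * det (S + \<eta> ** F ** \<beta>)"
proof -
  let ?M = "from_blocks S \<eta> (- \<beta>) E"
  have E: "\<eta> ** F ** E = \<eta>"
    using F by (metis matrix_mul_assoc matrix_mul_rid)
  have "?M = from_blocks S 0 (- \<beta>) (mat 1) ** from_blocks (mat 1) X 0 (E + \<beta> ** X)"
    by (simp add: from_blocks_mult X minus_matrix_mult)
  then have "det ?M = det S * det (E + \<beta> ** X)"
    by (simp add: det_mul det_from_blocks_lower_triangular det_from_blocks_upper_triangular)
  moreover have "?M = from_blocks (S + \<eta> ** F ** \<beta>) (\<eta> ** F) 0 (mat 1) ** from_blocks (mat 1) 0 (- \<beta>) E"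
    by (simp add: from_blocks_mult matrix_mult_minus E)
  then have "det ?M = det E * det (S + \<eta> ** F ** \<beta>)"
    by (simp add: det_mul det_from_blocks_lower_triangular det_from_blocks_upper_triangular)
  ultimately show ?thesis
    by simp
qed

corollary det_one_plus_mult_commute:
  "det (mat 1 + U ** V) = det (mat 1 + V ** U)" for U :: "real^'n^'k" and V :: "real^'k^'n"
  using det_bordered[of "mat 1" U U "mat 1" "mat 1" V] by simp

section \<open>The exponential series of a matrix\<close>

abbreviation mat_pow :: "real^'d^'d \<Rightarrow> nat \<Rightarrow> real^'d^'d" where
  "mat_pow M k \<equiv> ((**) M ^^ k) (mat 1)"

text \<open>The sum of the absolute values of all entries is a submultiplicative bound, so the series of each
  entry is dominated by a real exponential series.\<close>

lemma abs_mat_pow_le: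
  fixes M :: "real^'d^'d"
  shows "\<bar>mat_pow M k $ i $ j\<bar> \<le> (\<Sum>p\<in>UNIV. \<Sum>q\<in>UNIV. \<bar>M $ p $ q\<bar>) ^ k" (is "_ \<le> ?C ^ k")
proof (induction k arbitrary: i j)
  case 0
  show ?case
    by (simp add: mat_def)
next
  case (Suc k)
  have C: "0 \<le> ?C"
    by (simp add: sum_nonneg)
  have "\<bar>mat_pow M (Suc k) $ i $ j\<bar> \<le> (\<Sum>l\<in>UNIV. \<bar>M $ i $ l\<bar> * \<bar>mat_pow M k $ l $ j\<bar>)"
    by (simp add: matrix_matrix_mult_def flip: abs_mult)
  also have "\<dots> \<le> (\<Sum>l\<in>UNIV. \<bar>M $ i $ l\<bar> * ?C ^ k)"
    by (intro sum_mono mult_left_mono Suc.IH) auto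
  also have "\<dots> = (\<Sum>l\<in>UNIV. \<bar>M $ i $ l\<bar>) * ?C ^ k"
    by (simp add: sum_distrib_right)
  also have "\<dots> \<le> ?C * ?C ^ k"
    using C by (intro mult_right_mono member_le_sum) (auto simp: sum_nonneg)
  finally show ?case
    by simp
qed

lemma summable_mat_exp_entry:
  fixes M :: "real^'d^'d"
  shows "summable (\<lambda>k. \<bar>mat_pow M k $ i $ j / fact k\<bar>)"
proof (rule summable_comparison_test')
  let ?C = "\<Sum>p\<in>UNIV. \<Sum>q\<in>UNIV. \<bar>M $ p $ q\<bar>"
  show "summable (\<lambda>k. inverse (fact k) * ?C ^ k)"
    by (rule summable_exp)
  show "norm \<bar>mat_pow M k $ i $ j / fact k\<bar> \<le> inverse (fact k) * ?C ^ k" if "0 \<le> k" for k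
    using abs_mat_pow_le[of k M i j] by (simp add: divide_simps abs_divide)
qed

lemma sums_vecI:
  fixes f :: "nat \<Rightarrow> 'a::real_normed_vector ^ 'n"
  assumes "\<And>i. (\<lambda>k. f k $ i) sums (x $ i)"
  shows "f sums x"
  using assms unfolding sums_def by (intro vec_tendstoI) simp

lemma mat_exp_sums: "(\<lambda>k. (1 / fact k) *\<^sub>R mat_pow M k) sums mat_exp M"
proof -
  have "(\<lambda>k. ((1 / fact k) *\<^sub>R mat_pow M k) $ i $ j) sums (\<Sum>k. mat_pow M k $ i $ j / fact k)" for i j
    using summable_sums[OF summable_rabs_cancel[OF summable_mat_exp_entry[of M i j]]] by simp
  then have "(\<lambda>k. (1 / fact k) *\<^sub>R mat_pow M k) sums (\<chi> i j. \<Sum>k. mat_pow M k $ i $ j / fact k)"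
    by (intro sums_vecI) simp
  then show ?thesis
    by (simp add: mat_exp_def sums_iff)
qed

lemma mat_exp_entry_sums: "(\<lambda>k. mat_pow M k $ i $ j / fact k) sums (mat_exp M $ i $ j)"
  using sums_vec_nth[OF sums_vec_nth[OF mat_exp_sums], of M i j] by simp

lemma mat_pow_add: "mat_pow M (k + l) = mat_pow M k ** mat_pow M l"
  by (induction k) (simp_all add: matrix_mul_assoc)

lemma mat_pow_scaleR: "mat_pow (t *\<^sub>R M) k = t ^ k *\<^sub>R mat_pow M k"
  by (induction k) (simp_all add: matrix_scalar_ac flip: scalar_matrix_assoc)

text \<open>Entry by entry this is a sum of Cauchy products of real series, so the binomial theorem for the
  commuting factors suffices.\<close>

lemma mat_exp_scaleR_add:
  "mat_exp ((s + t) *\<^sub>R M) = mat_exp (s *\<^sub>R M) ** mat_exp (t *\<^sub>R M)"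
proof -
  define A where "A r k i j = mat_pow (r *\<^sub>R M) k $ i $ j / fact k" for r k i j
  have "(mat_exp (s *\<^sub>R M) ** mat_exp (t *\<^sub>R M)) $ i $ j = mat_exp ((s + t) *\<^sub>R M) $ i $ j" for i j
  proof -
    have "(\<lambda>n. \<Sum>k\<le>n. A s k i l * A t (n - k) l j) sums
        (mat_exp (s *\<^sub>R M) $ i $ l * mat_exp (t *\<^sub>R M) $ l $ j)" for l
      using Cauchy_product_sums[of "\<lambda>k. A s k i l" "\<lambda>k. A t k l j"]
        summable_mat_exp_entry[of "s *\<^sub>R M" i l] summable_mat_exp_entry[of "t *\<^sub>R M" l j]
        sums_unique[OF mat_exp_entry_sums[of "s *\<^sub>R M" i l]]
        sums_unique[OF mat_exp_entry_sums[of "t *\<^sub>R M" l j]]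
      unfolding A_def by simp
    then have "(\<lambda>n. \<Sum>l\<in>UNIV. \<Sum>k\<le>n. A s k i l * A t (n - k) l j) sums
        ((mat_exp (s *\<^sub>R M) ** mat_exp (t *\<^sub>R M)) $ i $ j)"
      unfolding matrix_matrix_mult_def by (simp add: sums_sum)
    moreover have "(\<Sum>l\<in>UNIV. \<Sum>k\<le>n. A s k i l * A t (n - k) l j) = A (s + t) n i j" for n
    proof -
      have "(\<Sum>l\<in>UNIV. \<Sum>k\<le>n. A s k i l * A t (n - k) l j)
          = (\<Sum>k\<le>n. \<Sum>l\<in>UNIV. A s k i l * A t (n - k) l j)"
        by (rule sum.swap)
      also have "\<dots> = (\<Sum>k\<le>n. of_nat (n choose k) * s ^ k * t ^ (n - k) * (mat_pow M n $ i $ j) / fact n)"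
      proof (rule sum.cong[OF refl])
        fix k assume k: "k \<in> {..n}"
        have "(\<Sum>l\<in>UNIV. A s k i l * A t (n - k) l j)
            = (s ^ k / fact k) * (t ^ (n - k) / fact (n - k)) * (mat_pow M k ** mat_pow M (n - k)) $ i $ j"
          by (simp add: A_def mat_pow_scaleR matrix_matrix_mult_def sum_distrib_left mult_ac)
        also have "mat_pow M k ** mat_pow M (n - k) = mat_pow M n"
          using k mat_pow_add[of k "n - k" M] by simp
        finally show "(\<Sum>l\<in>UNIV. A s k i l * A t (n - k) l j)
            = of_nat (n choose k) * s ^ k * t ^ (n - k) * (mat_pow M n $ i $ j) / fact n"
          using k by (simp add: binomial_fact field_simps)
      qed
      also have "\<dots> = (s + t) ^ n * (mat_pow M n $ i $ j) / fact n"
        by (simp add: binomial_ring sum_distrib_right sum_divide_distrib)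
      finally show ?thesis
        by (simp add: A_def mat_pow_scaleR)
    qed
    ultimately show ?thesis
      using mat_exp_entry_sums[of "(s + t) *\<^sub>R M" i j] unfolding A_def by (simp add: sums_iff)
  qed
  then show ?thesis
    by (simp add: vec_eq_iff)
qed

lemma mat_exp_0: "mat_exp (0 :: real^'d^'d) = mat 1"
proof -
  have "(\<lambda>k. (1 / fact k) *\<^sub>R mat_pow 0 k) sums (\<Sum>k\<in>{0}. (1 / fact k) *\<^sub>R mat_pow (0 :: real^'d^'d) k)"
  proof (rule sums_finite)
    show "(1 / fact k) *\<^sub>R mat_pow (0 :: real^'d^'d) k = 0" if "k \<notin> {0}" for k
      using that by (cases k) auto
  qed simp
  then show ?thesis
    by (simp add: mat_exp_def sums_iff)
qed

text \<open>Exponentials of different matrices are compared through linear images: if the images of their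
  powers agree term by term, so do the images of the exponentials.\<close>

lemma linear_mat_exp:
  fixes L :: "real^'d^'d \<Rightarrow> 'b::euclidean_space"
  assumes "linear L"
  shows "(\<lambda>k. (1 / fact k) *\<^sub>R L (mat_pow M k)) sums L (mat_exp M)"
  using bounded_linear.sums[OF assms[unfolded linear_conv_bounded_linear] mat_exp_sums[of M]]
  by (simp add: linear_cmul[OF assms])

lemma mat_exp_intertwine:
  assumes "P ** M = N ** P"
  shows "P ** mat_exp M = mat_exp N ** P"
proof -
  have "P ** mat_pow M k = mat_pow N k ** P" for k
    by (induction k) (simp, simp, metis assms matrix_mul_assoc)
  moreover have "(\<lambda>k. (1 / fact k) *\<^sub>R (P ** mat_pow M k)) sums (P ** mat_exp M)"
    by (rule linear_mat_exp) (simp add: linear_iff matrix_add_ldistrib matrix_scalar_ac flip: scalar_matrix_assoc)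
  moreover have "(\<lambda>k. (1 / fact k) *\<^sub>R (mat_pow N k ** P)) sums (mat_exp N ** P)"
    by (rule linear_mat_exp) (simp add: linear_iff matrix_add_rdistrib flip: scalar_matrix_assoc)
  ultimately show ?thesis
    by (simp add: sums_iff)
qed

text \<open>The recursion for powers multiplies from the left, transposition turns this into a multiplication
  from the right.\<close>

lemma mat_exp_transpose: "mat_exp (transpose M) = transpose (mat_exp M)"
proof -
  have "mat_pow (transpose M) k = transpose (mat_pow M k)" for k
  proof (induction k)
    case (Suc k)
    have "mat_pow M (Suc k) = mat_pow M k ** M"
      using mat_pow_add[of k 1 M] by simp
    then show ?case
      using Suc by (simp add: matrix_transpose_mul)
  qed simp
  moreover have "(\<lambda>k. (1 / fact k) *\<^sub>R transpose (mat_pow M k)) sums transpose (mat_exp M)"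
    by (rule linear_mat_exp) (simp add: linear_iff transpose_def vec_eq_iff)
  ultimately show ?thesis
    using mat_exp_sums[of "transpose M"] by (simp add: sums_iff)
qed

lemma block_diag_mult: "block_diag M N ** block_diag M' N' = block_diag (M ** M') (N ** N')"
  by (simp add: block_diag_eq_from_blocks from_blocks_mult)

lemma block_diag_scaleR: "t *\<^sub>R block_diag M N = block_diag (t *\<^sub>R M) (t *\<^sub>R N)"
  by (simp add: block_diag_eq_from_blocks vec_sum_eq_iff vec_eq_iff)

lemma mat_exp_block_diag:
  fixes M :: "real^'m^'m" and N :: "real^'n^'n"
  shows "mat_exp (block_diag M N) = block_diag (mat_exp M) (mat_exp N)"
proof -
  have pow: "mat_pow (block_diag M N) k = block_diag (mat_pow M k) (mat_pow N k)" for k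
    by (induction k)
       (simp_all add: block_diag_mult,
        simp add: block_diag_eq_from_blocks vec_sum_eq_iff vec_eq_iff mat_def)
  \<comment> \<open>The series is split into one summand for each block, each a linear image of one exponential
    series.\<close>
  have "(\<lambda>k. (1 / fact k) *\<^sub>R block_diag (mat_pow M k) 0) sums block_diag (mat_exp M) 0"
    by (rule linear_mat_exp)
       (simp add: linear_iff block_diag_eq_from_blocks vec_sum_eq_iff vec_eq_iff)
  moreover have "(\<lambda>k. (1 / fact k) *\<^sub>R block_diag 0 (mat_pow N k)) sums block_diag 0 (mat_exp N)"
    by (rule linear_mat_exp)
       (simp add: linear_iff block_diag_eq_from_blocks vec_sum_eq_iff vec_eq_iff)
  ultimately have "(\<lambda>k. (1 / fact k) *\<^sub>R block_diag (mat_pow M k) 0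
      + (1 / fact k) *\<^sub>R block_diag 0 (mat_pow N k)) sums (block_diag (mat_exp M) 0 + block_diag 0 (mat_exp N))"
    by (rule sums_add)
  moreover have "block_diag A 0 + block_diag 0 B = block_diag A B" for A :: "real^'m^'m" and B :: "real^'n^'n"
    by (simp add: block_diag_eq_from_blocks vec_sum_eq_iff vec_eq_iff)
  ultimately have "(\<lambda>k. (1 / fact k) *\<^sub>R mat_pow (block_diag M N) k) sums block_diag (mat_exp M) (mat_exp N)"
    by (simp add: pow flip: scaleR_add_right)
  then show ?thesis
    by (simp add: mat_exp_def sums_iff)
qed

section \<open>Matrices whose blocks are indexed by the stages\<close>

text \<open>Blocks are indexed by the stages \<open>'s\<close>, the entries of each block by \<open>'d\<close>.\<close>

definition block_matrix :: "('s::finite \<Rightarrow> 's \<Rightarrow> real^'d^'d) \<Rightarrow> real^('s \<times> 'd)^('s \<times> 'd)" where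
  "block_matrix X = (\<chi> p q. X (fst p) (fst q) $ snd p $ snd q)"

definition block_column :: "('s::finite \<Rightarrow> real^'q^'d) \<Rightarrow> real^'q^('s \<times> 'd)" where
  "block_column X = (\<chi> p. X (fst p) $ snd p)"

definition block_row :: "('s::finite \<Rightarrow> real^'d^'d) \<Rightarrow> real^('s \<times> 'd)^'d" where
  "block_row X = (\<chi> i q. X (fst q) $ i $ snd q)"

lemma sum_UNIV_Times:
  "(\<Sum>p\<in>UNIV. f p) = (\<Sum>i\<in>UNIV. \<Sum>j\<in>UNIV. f (i, j))"
  for f :: "'s::finite \<times> 'd::finite \<Rightarrow> 'b::comm_monoid_add"
  by (simp add: sum.cartesian_product flip: UNIV_Times_UNIV)

lemma block_matrix_mult_matrix:
  "block_matrix X ** block_matrix Y = block_matrix (\<lambda>i j. \<Sum>l\<in>UNIV. X i l ** Y l j)"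
  by (simp add: block_matrix_def matrix_matrix_mult_def vec_eq_iff sum_UNIV_Times)

lemma block_matrix_mult_column:
  "block_matrix X ** block_column Y = block_column (\<lambda>i. \<Sum>l\<in>UNIV. X i l ** Y l)"
  by (simp add: block_matrix_def block_column_def matrix_matrix_mult_def vec_eq_iff sum_UNIV_Times)

lemma block_row_mult_column:
  "block_row X ** block_column Y = (\<Sum>l\<in>UNIV. X l ** Y l)"
  by (simp add: block_row_def block_column_def matrix_matrix_mult_def vec_eq_iff sum_UNIV_Times)

lemma block_column_mult_row:
  "block_column X ** block_row Y = block_matrix (\<lambda>i j. X i ** Y j)"
  by (simp add: block_matrix_def block_row_def block_column_def matrix_matrix_mult_def vec_eq_iff)

lemma block_column_mult: "block_column X ** A = block_column (\<lambda>i. X i ** A)"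
  by (simp add: block_column_def matrix_matrix_mult_def vec_eq_iff)

lemma block_matrix_add: "block_matrix X + block_matrix Y = block_matrix (\<lambda>i j. X i j + Y i j)"
  by (simp add: block_matrix_def vec_eq_iff)

lemma block_matrix_minus: "- block_matrix X = block_matrix (\<lambda>i j. - X i j)"
  by (simp add: block_matrix_def vec_eq_iff)

lemma transpose_block_matrix: "transpose (block_matrix X) = block_matrix (\<lambda>i j. transpose (X j i))"
  by (simp add: block_matrix_def vec_eq_iff transpose_def)

definition diagonal_blocks :: "('s::finite \<Rightarrow> real^'d^'d) \<Rightarrow> real^('s \<times> 'd)^('s \<times> 'd)" where
  "diagonal_blocks X = block_matrix (\<lambda>i j. if i = j then X i else 0)"

lemma mat_1_eq_diagonal_blocks: "mat 1 = diagonal_blocks (\<lambda>_. mat 1)"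
  by (auto simp: diagonal_blocks_def block_matrix_def vec_eq_iff mat_def)

lemma diagonal_blocks_mult: "diagonal_blocks X ** block_matrix Y = block_matrix (\<lambda>i j. X i ** Y i j)"
proof -
  have "(if i = l then X i else 0) ** Y l j = (if i = l then X i ** Y i j else 0)" for i l j
    by simp
  then show ?thesis
    by (simp add: diagonal_blocks_def block_matrix_mult_matrix)
qed

lemma mult_diagonal_blocks: "block_matrix Y ** diagonal_blocks X = block_matrix (\<lambda>i j. Y i j ** X j)"
proof -
  have "Y i l ** (if l = j then X l else 0) = (if l = j then Y i j ** X j else 0)" for i l j
    by simp
  then show ?thesis
    by (simp add: diagonal_blocks_def block_matrix_mult_matrix)
qed

lemma diagonal_blocks_mult_diagonal_blocks: "diagonal_blocks X ** diagonal_blocks Y = diagonal_blocks (\<lambda>i. X i ** Y i)"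
  unfolding diagonal_blocks_def[of Y] diagonal_blocks_mult
  by (auto simp: diagonal_blocks_def intro!: arg_cong[of _ _ block_matrix] ext)

lemma det_diagonal_blocks_nonzero:
  assumes "\<And>i. invertible (X i)"
  shows "det (diagonal_blocks X) \<noteq> 0"
proof -
  obtain Y where "\<And>i. X i ** Y i = mat 1"
    using assms unfolding invertible_def by metis
  then have "diagonal_blocks X ** diagonal_blocks Y = mat 1"
    by (simp add: diagonal_blocks_mult_diagonal_blocks mat_1_eq_diagonal_blocks)
  then show ?thesis
    by (metis invertible_det_nz invertible_right_inverse)
qed

lemma block_one_minus_mult_column:
  "block_matrix (\<lambda>i j. (if i = j then mat 1 else 0) - W i j) ** block_column X
     = block_column (\<lambda>i. X i - (\<Sum>j\<in>UNIV. W i j ** X j))"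
proof -
  have "((if i = j then mat 1 else 0) - W i j) ** X j = (if i = j then X j else 0) - W i j ** X j" for i j
    by (simp add: matrix_diff_rdistrib)
  then show ?thesis
    by (simp add: block_matrix_mult_column sum_subtractf)
qed

section \<open>Symplectic Runge--Kutta methods and skew linear systems\<close>

text \<open>Without the inverse the condition says that \<open>A\<close> is skew with respect to the bilinear form
  \<open>P\<close>.\<close>

lemma skew_adjoint_of_similar:
  fixes A P :: "real^'n^'n"
  assumes "invertible P" and "P ** A ** matrix_inv P = - transpose A"
  shows "P ** A = - (transpose A ** P)"
proof -
  have "matrix_inv P ** P = mat 1"
    using someI_ex[OF assms(1)[unfolded invertible_def]] by (simp add: matrix_inv_def)
  then have "P ** A ** matrix_inv P ** P = P ** A"
    by (simp flip: matrix_mul_assoc)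
  then show ?thesis
    using assms(2) by (simp add: minus_matrix_mult)
qed

text \<open>The flow of a linear field that is skew with respect to the form \<open>P\<close> preserves this form:
  \<open>P\<close> intertwines \<open>M\<close> with \<open>- M\<^sup>T\<close>, hence their exponentials.\<close>

lemma transpose_mat_exp_bilinear_form:
  fixes M P :: "real^'n^'n"
  assumes "P ** M = - (transpose M ** P)"
  shows "transpose (mat_exp (t *\<^sub>R M)) ** P ** mat_exp (t *\<^sub>R M) = P"
proof -
  let ?N = "(- t) *\<^sub>R transpose M"
  have "P ** (t *\<^sub>R M) = ?N ** P"
    using assms by (simp add: matrix_mult_scaleR minus_matrix_mult)
  then have "P ** mat_exp (t *\<^sub>R M) = mat_exp ?N ** P"
    by (rule mat_exp_intertwine)
  moreover have "transpose (mat_exp (t *\<^sub>R M)) ** mat_exp ?N = mat 1"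
    using mat_exp_scaleR_add[of t "- t" "transpose M"]
    by (simp add: mat_exp_0 transpose_scalar flip: mat_exp_transpose)
  ultimately show ?thesis
    by (metis matrix_mul_assoc matrix_mul_lid)
qed

text \<open>Invariance of a nondegenerate form gives only \<open>det B = 1\<close> or \<open>det B = - 1\<close>; the sign
  disappears in the square.  For an exponential, \<open>B\<close> is the half step.\<close>

lemma det_eq_1_of_bilinear_form_square:
  fixes P B :: "real^'n^'n"
  assumes "invertible P" and "transpose B ** P ** B = P"
  shows "det (B ** B) = 1"
proof -
  have "det B * det B * det P = det P"
    using arg_cong[OF assms(2), of det] by (simp add: det_mul mult_ac)
  then show ?thesis
    using assms(1) by (simp add: det_mul invertible_det_nz)
qed

text \<open>The exponential integrator on a linear nonautonomous equation: \<open>E\<close> stands for the flow of the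
  linear part, with time measured in steps, \<open>G j\<close> for the matrix of the remaining part at stage \<open>j\<close>, and \<open>X j\<close> for the stages, as
  matrices acting on the initial value.  With \<open>E\<^sub>i\<^sub>j = E (c\<^sub>i - c\<^sub>j)\<close>, the proof relates the stage matrix
  \<open>S\<close>, with blocks \<open>1 - h a\<^sub>i\<^sub>j E\<^sub>i\<^sub>j G\<^sub>j\<close>, to the matrix \<open>T\<close> that has \<open>a\<^sub>i\<^sub>j - b\<^sub>j\<close> in place of \<open>a\<^sub>i\<^sub>j\<close>,
  through the chain \<open>T\<close>, \<open>T'\<close>, \<open>R\<close>, \<open>S\<close> of matrices with equal determinant.\<close>

lemma det_symplectic_RK_eq_1:
  fixes G :: "'s::finite \<Rightarrow> real^'n^'n" and X :: "'s \<Rightarrow> real^'n^'n"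
    and E :: "real \<Rightarrow> real^'n^'n" and P :: "real^'n^'n"
    and c b :: "real^'s" and a :: "real^'s^'s" and h :: real
  assumes RK: "symplectic_RK b a" "\<And>j. b $ j \<noteq> 0"
    and P: "invertible P"
    and E_add: "\<And>s t. E (s + t) = E s ** E t" and E_0: "E 0 = mat 1"
    and E_P: "\<And>t. transpose (E t) ** P ** E t = P"
    and G_P: "\<And>i. P ** G i = - (transpose (G i) ** P)"
    and S: "det (block_matrix (\<lambda>i j. (if i = j then mat 1 else 0)
              - (h * a$i$j) *\<^sub>R (E (c$i - c$j) ** G j))) \<noteq> 0"
    and X: "\<And>i. X i = E (c$i) + (\<Sum>j\<in>UNIV. (h * a$i$j) *\<^sub>R (E (c$i - c$j) ** G j ** X j))"
  shows "det (E 1 + (\<Sum>j\<in>UNIV. (h * b$j) *\<^sub>R (E (1 - c$j) ** G j ** X j))) = 1"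
    (is "det ?D = 1")
proof -
  let ?E = "\<lambda>i j. E (c$i - c$j)"
  let ?W = "\<lambda>w. block_matrix (\<lambda>i j. (if i = j then mat 1 else 0) + w i j *\<^sub>R (?E i j ** G j))"
  define S where "S = ?W (\<lambda>i j. - (h * a$i$j))"
  define T where "T = ?W (\<lambda>i j. h * (b$j - a$i$j))"
  define T' where "T' = ?W (\<lambda>i j. h * a$j$i)"
  define R where "R = block_matrix (\<lambda>i j. (if i = j then mat 1 else 0) - (h * a$i$j) *\<^sub>R (G i ** ?E i j))"
  define \<beta> where "\<beta> = block_row (\<lambda>j. (h * b$j) *\<^sub>R (E (1 - c$j) ** G j))"
  define \<eta> where "\<eta> = block_column (\<lambda>i. E (c$i))"
  have S_eq: "S = block_matrix (\<lambda>i j. (if i = j then mat 1 else 0) - (h * a$i$j) *\<^sub>R (?E i j ** G j))"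
    by (simp add: S_def)
  then have S_nz: "det S \<noteq> 0"
    using S by simp
  have SX: "S ** block_column X = \<eta>"
  proof -
    have "X i - (\<Sum>j\<in>UNIV. (h * a$i$j) *\<^sub>R (?E i j ** G j ** X j)) = E (c$i)" for i
      by (subst X) simp
    then show ?thesis
      unfolding S_eq block_one_minus_mult_column by (simp add: \<eta>_def matrix_mult_scaleR)
  qed
  have F: "E (-1) ** E 1 = mat 1"
    by (simp add: E_0 flip: E_add)
  have "det S * det (E 1 + \<beta> ** block_column X) = det (E 1) * det (S + \<eta> ** E (-1) ** \<beta>)"
    by (rule det_bordered[OF SX F])
  moreover have "E 1 + \<beta> ** block_column X = ?D"
    by (simp add: \<beta>_def block_row_mult_column matrix_mult_scaleR)
  moreover have "S + \<eta> ** E (-1) ** \<beta> = T"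
  proof -
    have "E (c$i) ** E (-1) ** (E (1 - c$j) ** G j) = ?E i j ** G j" for i j
      by (simp add: matrix_mul_assoc flip: E_add)
    then show ?thesis
      by (simp add: S_def T_def \<beta>_def \<eta>_def block_column_mult[where A = "E (-1)"] block_column_mult_row block_matrix_add
          matrix_mult_scaleR algebra_simps)
  qed
  moreover have "det (E 1) = 1"
    using det_eq_1_of_bilinear_form_square[OF P E_P[of "1/2"]] by (simp flip: E_add)
  ultimately have main: "det S * det ?D = det T"
    by simp

  have b_inv: "invertible (b$i *\<^sub>R (mat 1 :: real^'n^'n))" for i
    using RK(2)[of i] by (auto simp: invertible_right_inverse matrix_mult_scaleR intro!: exI[of _ "inverse (b$i) *\<^sub>R mat 1"])
  \<comment> \<open>Symplecticity exchanges the two coefficient matrices up to a conjugation by the weights.\<close>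
  have "det T = det T'"
  proof -
    let ?B = "diagonal_blocks (\<lambda>i. b$i *\<^sub>R (mat 1 :: real^'n^'n))"
    have "b$i * (b$j - a$i$j) = b$j * a$j$i" for i j
      using RK(1) unfolding symplectic_RK_def by (simp add: algebra_simps)
    then have weights: "b$i * (h * (b$j - a$i$j)) = b$j * (h * a$j$i)" for i j
      by (metis mult.left_commute)
    have "?B ** T = T' ** ?B"
      unfolding T_def T'_def diagonal_blocks_mult mult_diagonal_blocks
    proof (intro arg_cong[of _ _ block_matrix] ext)
      fix i j
      let ?Z = "?E i j ** G j"
      have "b$i *\<^sub>R mat 1 ** ((if i = j then mat 1 else 0) + (h * (b$j - a$i$j)) *\<^sub>R ?Z)
          = (if i = j then b$j *\<^sub>R mat 1 else 0) + (b$i * (h * (b$j - a$i$j))) *\<^sub>R ?Z"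
        by (simp add: matrix_mult_scaleR scaleR_add_right)
      also have "\<dots> = ((if i = j then mat 1 else 0) + (h * a$j$i) *\<^sub>R ?Z) ** b$j *\<^sub>R mat 1"
        unfolding weights by (simp add: matrix_mult_scaleR scaleR_add_right)
      finally show "b$i *\<^sub>R mat 1 ** ((if i = j then mat 1 else 0) + (h * (b$j - a$i$j)) *\<^sub>R ?Z)
          = ((if i = j then mat 1 else 0) + (h * a$j$i) *\<^sub>R ?Z) ** b$j *\<^sub>R mat 1" .
    qed
    from arg_cong[OF this, of det] show ?thesis
      using det_diagonal_blocks_nonzero[of "\<lambda>i. b$i *\<^sub>R mat 1", OF b_inv] by (simp add: det_mul)
  qed
  \<comment> \<open>Transposition restores the order of the indices of the coefficients; the form \<open>P\<close> removes the
    transposition of the blocks, at the price of the reversed order of the factors.\<close>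
  also have "\<dots> = det R"
  proof -
    let ?P = "diagonal_blocks (\<lambda>i :: 's. P)"
    have adj: "transpose (G i) ** (transpose (?E j i) ** P) = - (P ** (G i ** ?E i j))" for i j
    proof -
      have "transpose (?E j i) ** P = transpose (?E j i) ** P ** (?E j i ** ?E i j)"
        by (simp add: E_0 flip: E_add)
      then have "transpose (?E j i) ** P = P ** ?E i j"
        using E_P[of "c$j - c$i"] by (simp add: matrix_mul_assoc)
      then show ?thesis
        using G_P[of i] by (simp add: matrix_mul_assoc minus_matrix_mult)
    qed
    have "transpose T' ** ?P = ?P ** R"
      unfolding T'_def R_def transpose_block_matrix diagonal_blocks_mult mult_diagonal_blocks
    proof (intro arg_cong[of _ _ block_matrix] ext)
      fix i j
      have "transpose ((if j = i then mat 1 else 0) + (h * a$i$j) *\<^sub>R (?E j i ** G i)) ** P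
          = (if i = j then P else 0) + (h * a$i$j) *\<^sub>R (transpose (G i) ** (transpose (?E j i) ** P))"
        by (simp add: transpose_add transpose_scalar matrix_transpose_mul matrix_add_rdistrib
            matrix_mult_scaleR matrix_mul_assoc)
      also have "\<dots> = P ** ((if i = j then mat 1 else 0) - (h * a$i$j) *\<^sub>R (G i ** ?E i j))"
        unfolding adj by (simp add: matrix_diff_ldistrib matrix_mult_scaleR)
      finally show "transpose ((if j = i then mat 1 else 0) + (h * a$i$j) *\<^sub>R (?E j i ** G i)) ** P
          = P ** ((if i = j then mat 1 else 0) - (h * a$i$j) *\<^sub>R (G i ** ?E i j))" .
    qed
    from arg_cong[OF this, of det] show ?thesis
      using det_diagonal_blocks_nonzero[of "\<lambda>i :: 's. P", OF P] by (simp add: det_mul)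
  qed
  \<comment> \<open>The factors are put back into the original order.\<close>
  also have "\<dots> = det S"
  proof -
    let ?V = "block_matrix (\<lambda>i j. (h * a$i$j) *\<^sub>R ?E i j)"
    have "R = mat 1 + (- diagonal_blocks G) ** ?V"
      unfolding minus_matrix_mult diagonal_blocks_mult
      by (simp add: R_def mat_1_eq_diagonal_blocks diagonal_blocks_def block_matrix_minus block_matrix_add matrix_mult_scaleR)
    moreover have "S = mat 1 + ?V ** (- diagonal_blocks G)"
      unfolding matrix_mult_minus mult_diagonal_blocks
      by (simp add: S_def mat_1_eq_diagonal_blocks diagonal_blocks_def block_matrix_minus block_matrix_add matrix_mult_scaleR)
    ultimately show ?thesis
      by (simp only: det_one_plus_mult_commute[of "- diagonal_blocks G" ?V])
  qed
  finally show ?thesis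
    using main S_nz by simp
qed

section \<open>Diagonal blocks of the derivative\<close>

definition block11 :: "real^('m::finite + 'n::finite)^('m::finite + 'n::finite) \<Rightarrow> real^'m^'m" where
  "block11 M = (\<chi> i j. M $ Inl i $ Inl j)"
definition block21 :: "real^('m::finite + 'n::finite)^('m::finite + 'n::finite) \<Rightarrow> real^'m^'n" where
  "block21 M = (\<chi> i j. M $ Inr i $ Inl j)"
definition block22 :: "real^('m::finite + 'n::finite)^('m::finite + 'n::finite) \<Rightarrow> real^'n^'n" where
  "block22 M = (\<chi> i j. M $ Inr i $ Inr j)"
definition block12 :: "real^('m::finite + 'n::finite)^('m::finite + 'n::finite) \<Rightarrow> real^'n^'m" where
  "block12 M = (\<chi> i j. M $ Inl i $ Inr j)"

lemmas block_defs = block11_def block12_def block21_def block22_def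

lemma from_blocks_of_matrix:
  "M = from_blocks (block11 M) (block12 M) (block21 M) (block22 M)"
  by (simp add: vec_sum_eq_iff block_defs)

lemma blocks_of_mult:
  fixes M N :: "real^('m::finite + 'n::finite)^('m::finite + 'n::finite)"
  shows "block11 (M ** N) = block11 M ** block11 N + block12 M ** block21 N"
    and "block12 (M ** N) = block11 M ** block12 N + block12 M ** block22 N"
    and "block22 (M ** N) = block21 M ** block12 N + block22 M ** block22 N"
  by (simp_all add: block_defs matrix_matrix_mult_def vec_eq_iff sum_UNIV_Plus)

lemma blocks_linear:
  "linear (block11 :: real^('m::finite + 'n::finite)^('m::finite + 'n::finite) \<Rightarrow> real^'m^'m)"
  "linear (block12 :: real^('m::finite + 'n::finite)^('m::finite + 'n::finite) \<Rightarrow> real^'n^'m)"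
  "linear (block22 :: real^('m::finite + 'n::finite)^('m::finite + 'n::finite) \<Rightarrow> real^'n^'n)"
  by (simp_all add: linear_iff block_defs vec_eq_iff)

lemmas block_linear_simps =
  blocks_linear[THEN linear_add] blocks_linear[THEN linear_diff]
  blocks_linear[THEN linear_cmul] blocks_linear[THEN linear_sum] blocks_linear[THEN linear_0]

lemma blocks_of_mat_1 [simp]:
  "block11 (mat 1) = mat 1" "block12 (mat 1) = 0" "block22 (mat 1) = mat 1"
  by (simp_all add: block_defs mat_def vec_eq_iff)

lemma blocks_of_block_diag [simp]:
  "block11 (block_diag M N) = M" "block12 (block_diag M N) = 0"
  "block21 (block_diag M N) = 0" "block22 (block_diag M N) = N"
  by (simp_all add: block_defs block_diag_def vec_eq_iff)

definition upper_part :: "real^('m::finite + 'n::finite) \<Rightarrow> real^'m" where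
  "upper_part x = (\<chi> i. x $ Inl i)"
definition lower_part :: "real^('m::finite + 'n::finite) \<Rightarrow> real^'n" where
  "lower_part x = (\<chi> j. x $ Inr j)"

lemma parts_of_stack [simp]: "upper_part (stack x y) = x" "lower_part (stack x y) = y"
  by (simp_all add: upper_part_def lower_part_def vec_eq_iff)

lemma stack_parts [simp]: "stack (upper_part x) (lower_part x) = x"
  by (simp add: vec_sum_eq_iff upper_part_def lower_part_def)

lemma parts_linear: "linear (upper_part :: real^('m::finite + 'n::finite) \<Rightarrow> real^'m)"
  "linear (lower_part :: real^('m::finite + 'n::finite) \<Rightarrow> real^'n)"
  by (simp_all add: linear_iff upper_part_def lower_part_def vec_eq_iff)

lemma upper_part_block_diag_mult: "upper_part (block_diag M N *v x) = M *v upper_part x"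
  by (simp add: upper_part_def block_diag_def matrix_vector_mult_def vec_eq_iff sum_UNIV_Plus)

lemma parts_of_mult_stack: "upper_part (M *v stack x 0) = block11 M *v x"
  "upper_part (M *v stack 0 y) = block12 M *v y"
  "lower_part (M *v stack 0 y) = block22 M *v y"
  by (simp_all add: upper_part_def lower_part_def block_defs matrix_vector_mult_def vec_eq_iff sum_UNIV_Plus)

lemma stack_bounded_linear: "bounded_linear (\<lambda>x. stack x 0)" "bounded_linear (\<lambda>y. stack 0 y)"
  by (simp_all add: linear_iff vec_sum_eq_iff flip: linear_conv_bounded_linear)

lemma has_derivative_stack:
  "((\<lambda>x. stack x y) has_derivative (\<lambda>v. stack v 0)) F"
  "((\<lambda>y. stack x y) has_derivative (\<lambda>v. stack 0 v)) F"
proof -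
  have eq: "(\<lambda>x. stack x 0 + stack 0 y) = (\<lambda>x. stack x y)" "(\<lambda>y. stack x 0 + stack 0 y) = (\<lambda>y. stack x y)"
    by (simp_all add: vec_sum_eq_iff fun_eq_iff)
  have "((\<lambda>x. stack x 0 + stack 0 y) has_derivative (\<lambda>v. stack v 0 + 0)) F"
    by (intro has_derivative_add has_derivative_const bounded_linear_imp_has_derivative stack_bounded_linear)
  then show "((\<lambda>x. stack x y) has_derivative (\<lambda>v. stack v 0)) F"
    by (simp only: eq add_0_right)
  have "((\<lambda>y. stack x 0 + stack 0 y) has_derivative (\<lambda>v. 0 + stack 0 v)) F"
    by (intro has_derivative_add has_derivative_const bounded_linear_imp_has_derivative stack_bounded_linear)
  then show "((\<lambda>y. stack x y) has_derivative (\<lambda>v. stack 0 v)) F"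
    by (simp only: eq add_0_left)
qed

lemma jacobian_eqI: "(f has_derivative (\<lambda>v. J *v v)) (at x) \<Longrightarrow> jacobian f (at x) = J"
  for f :: "real^'n \<Rightarrow> real^'m"
  using frechet_derivative_at[of f] by (metis jacobian_def matrix_of_matrix_vector_mul)

lemma partial_has_derivative:
  fixes f :: "real^('m::finite + 'n::finite) \<Rightarrow> real^('m::finite + 'n::finite)" and x :: "real^'m" and y :: "real^'n"
  assumes "f differentiable (at (stack x y))"
  shows "((\<lambda>x. upper_part (f (stack x y))) has_derivative (*v) (block11 (jacobian f (at (stack x y))))) (at x)"
    and "((\<lambda>y. upper_part (f (stack x y))) has_derivative (*v) (block12 (jacobian f (at (stack x y))))) (at y)"
    and "((\<lambda>y. lower_part (f (stack x y))) has_derivative (*v) (block22 (jacobian f (at (stack x y))))) (at y)"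
proof -
  have f: "(f has_derivative (*v) (jacobian f (at (stack x y)))) (at (stack x y))"
    using assms by (simp add: jacobian_works)
  note part = parts_linear[unfolded linear_conv_bounded_linear, THEN bounded_linear.has_derivative]
  note derivs = diff_chain_at[OF has_derivative_stack(1) f, unfolded o_def]
    diff_chain_at[OF has_derivative_stack(2) f, unfolded o_def]
  show "((\<lambda>x. upper_part (f (stack x y))) has_derivative (*v) (block11 (jacobian f (at (stack x y))))) (at x)"
    using part(1)[OF derivs(1)] by (simp add: parts_of_mult_stack)
  show "((\<lambda>y. upper_part (f (stack x y))) has_derivative (*v) (block12 (jacobian f (at (stack x y))))) (at y)"
    using part(1)[OF derivs(2)] by (simp add: parts_of_mult_stack)
  show "((\<lambda>y. lower_part (f (stack x y))) has_derivative (*v) (block22 (jacobian f (at (stack x y))))) (at y)"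
    using part(2)[OF derivs(2)] by (simp add: parts_of_mult_stack)
qed

lemma has_derivative_exponential_combination:
  fixes A :: "real^'d^'d" and B :: "'s::finite \<Rightarrow> real^'d^'d" and g :: "real^'d \<Rightarrow> real^'d" and k :: "'s \<Rightarrow> real^'d \<Rightarrow> real^'d"
  assumes g: "\<And>y. g differentiable (at y)" and k: "\<And>j. k j differentiable (at y)"
  shows "((\<lambda>y. A *v y + h *\<^sub>R (\<Sum>j\<in>UNIV. w j *\<^sub>R (B j *v g (k j y)))) has_derivative
     (*v) (A + (\<Sum>j\<in>UNIV. (h * w j) *\<^sub>R (B j ** jacobian g (at (k j y)) ** jacobian (k j) (at y))))) (at y)"
proof -
  have mult: "((\<lambda>y. M *v F y) has_derivative (\<lambda>v. M *v F' v)) (at y)"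
    if "(F has_derivative F') (at y)" for M :: "real^'d^'d" and F F' :: "real^'d \<Rightarrow> real^'d"
    by (rule bounded_linear.has_derivative[OF _ that]) simp
  have "((\<lambda>y. g (k j y)) has_derivative
      (\<lambda>v. jacobian g (at (k j y)) *v (jacobian (k j) (at y) *v v))) (at y)" for j
    using diff_chain_at[of "k j" _ y g] g k by (simp add: jacobian_works o_def)
  then have "((\<lambda>y. A *v y + h *\<^sub>R (\<Sum>j\<in>UNIV. w j *\<^sub>R (B j *v g (k j y)))) has_derivative
      (\<lambda>v. A *v v + h *\<^sub>R (\<Sum>j\<in>UNIV. w j *\<^sub>R (B j *v (jacobian g (at (k j y)) *v (jacobian (k j) (at y) *v v)))))) (at y)"
    by (auto intro!: has_derivative_add has_derivative_scaleR_right has_derivative_sum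
        bounded_linear_imp_has_derivative mult)
  also have "(\<lambda>v. A *v v + h *\<^sub>R (\<Sum>j\<in>UNIV. w j *\<^sub>R (B j *v (jacobian g (at (k j y)) *v (jacobian (k j) (at y) *v v)))))
      = (*v) (A + (\<Sum>j\<in>UNIV. (h * w j) *\<^sub>R (B j ** jacobian g (at (k j y)) ** jacobian (k j) (at y))))"
    by (simp add: fun_eq_iff matrix_vector_mult_add_rdistrib matrix_sum_vector_mult scaleR_sum_right
        matrix_vector_mul_assoc matrix_mul_assoc flip: scaleR_matrix_vector_assoc)
  finally show ?thesis .
qed

section \<open>The method on the driving subsystem\<close>

lemma ssei_stage_matrix_eq_block_matrix:
  "ssei_stage_matrix c a h K g x = block_matrix (\<lambda>i j. (if i = j then mat 1 else 0)
     - (h * a$i$j) *\<^sub>R (mat_exp (((c$i - c$j) * h) *\<^sub>R K) ** jacobian g (at (x j))))"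
  by (simp add: ssei_stage_matrix_def block_matrix_def)

text \<open>The whole matrix is block lower triangular after sorting the coordinates by the two components instead
  of by the stages.  Rather than permuting coordinates, the proof shows that the upper diagonal block
  is onto, because a solution for a right-hand side can be restricted, and that the lower one is
  injective, because a kernel vector can be extended by zero.\<close>

lemma invertible_diagonal_blocks:
  fixes M :: "'s::finite \<Rightarrow> 's \<Rightarrow> real^('m::finite + 'n::finite)^('m::finite + 'n::finite)"
  assumes inv: "invertible (block_matrix M)" and corner: "\<And>i j. block12 (M i j) = 0"
  shows "invertible (block_matrix (\<lambda>i j. block11 (M i j)))"
    and "invertible (block_matrix (\<lambda>i j. block22 (M i j)))"
proof -
  have zero: "M i j $ Inl p $ Inr q = 0" for i j p q
    using corner[of i j] by (simp add: block12_def vec_eq_iff)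
  let ?U = "block_matrix (\<lambda>i j. block11 (M i j))" and ?L = "block_matrix (\<lambda>i j. block22 (M i j))"
  obtain N where right: "block_matrix M ** N = mat 1" and left: "N ** block_matrix M = mat 1"
    using inv unfolding invertible_def by blast
  have "\<exists>x. w = ?U *v x" for w
  proof -
    define w' :: "real^('s \<times> ('m + 'n))" where "w' = (\<chi> p. case snd p of Inl r \<Rightarrow> w $ (fst p, r) | Inr r \<Rightarrow> 0)"
    define z where "z = N *v w'"
    have z: "block_matrix M *v z = w'"
      by (simp add: z_def matrix_vector_mul_assoc right)
    have "(?U *v (\<chi> p. z $ (fst p, Inl (snd p)))) $ (i, r) = (block_matrix M *v z) $ (i, Inl r)" for i r
      by (simp add: block_matrix_def block11_def matrix_vector_mult_def sum_UNIV_Times sum_UNIV_Plus zero)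
    then have "w = ?U *v (\<chi> p. z $ (fst p, Inl (snd p)))"
      unfolding z by (simp add: w'_def vec_eq_iff)
    then show ?thesis
      by (rule exI)
  qed
  then have "surj ((*v) ?U)"
    unfolding surj_def by blast
  then show "invertible ?U"
    unfolding invertible_right_inverse matrix_right_invertible_surjective .
  have "z = 0" if "?L *v z = 0" for z
  proof -
    define z' :: "real^('s \<times> ('m + 'n))" where "z' = (\<chi> p. case snd p of Inl r \<Rightarrow> 0 | Inr r \<Rightarrow> z $ (fst p, r))"
    have "(block_matrix M *v z') $ (i, Inl r) = 0" for i r
      by (simp add: z'_def block_matrix_def matrix_vector_mult_def sum_UNIV_Times sum_UNIV_Plus zero)
    moreover have "(block_matrix M *v z') $ (i, Inr r) = (?L *v z) $ (i, r)" for i r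
      by (simp add: z'_def block_matrix_def block22_def matrix_vector_mult_def sum_UNIV_Times sum_UNIV_Plus)
    ultimately have "(block_matrix M *v z') $ (i, r) = 0" for i r
      using that by (cases r) simp_all
    then have "block_matrix M *v z' = 0"
      by (simp add: vec_eq_iff)
    then have "N *v (block_matrix M *v z') = 0"
      by simp
    then have "z' = 0"
      by (simp add: matrix_vector_mul_assoc left)
    then have "z' $ (i, Inr r) = 0" for i r
      by simp
    then show ?thesis
      by (simp add: z'_def vec_eq_iff)
  qed
  then show "invertible ?L"
    unfolding invertible_left_inverse matrix_left_invertible_ker by blast
qed

lemma jacobian_blocks:
  assumes g: "\<And>y1 y2. g (stack y1 y2) = stack (g1 y1) (g2 y1 y2)"
    and g_diff: "g differentiable (at z)"
  shows "block11 (jacobian g (at z)) = jacobian g1 (at (upper_part z))"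
    and "block12 (jacobian g (at z)) = 0"
    and "block22 (jacobian g (at z)) = jacobian (g2 (upper_part z)) (at (lower_part z))"
    and "g2 (upper_part z) differentiable (at (lower_part z))"
proof -
  note D = partial_has_derivative[of g "upper_part z" "lower_part z", unfolded stack_parts, OF g_diff,
      unfolded g parts_of_stack]
  show "block11 (jacobian g (at z)) = jacobian g1 (at (upper_part z))"
    using jacobian_eqI[OF D(1)] by simp
  show "block12 (jacobian g (at z)) = 0"
    using jacobian_eqI[OF D(2)] jacobian_eqI[of "\<lambda>_. g1 (upper_part z)" 0 "lower_part z"] by simp
  show "block22 (jacobian g (at z)) = jacobian (g2 (upper_part z)) (at (lower_part z))"
    using jacobian_eqI[OF D(3)] by simp
  show "g2 (upper_part z) differentiable (at (lower_part z))"
    using differentiableI[OF D(3)] by simp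
qed

lemma mat_exp_scaled_block_diag:
  "mat_exp (t *\<^sub>R block_diag M N) = block_diag (mat_exp (t *\<^sub>R M)) (mat_exp (t *\<^sub>R N))"
  by (simp add: block_diag_scaleR mat_exp_block_diag)

lemma invertible_stage_matrix_blocks:
  assumes inv: "invertible (ssei_stage_matrix c a h (block_diag K11 K22) g x)"
    and corner: "\<And>j. block12 (jacobian g (at (x j))) = 0"
  shows "invertible (block_matrix (\<lambda>i j. (if i = j then mat 1 else 0)
      - (h * a$i$j) *\<^sub>R (mat_exp (((c$i - c$j) * h) *\<^sub>R K11) ** block11 (jacobian g (at (x j))))))"
    and "invertible (block_matrix (\<lambda>i j. (if i = j then mat 1 else 0)
      - (h * a$i$j) *\<^sub>R (mat_exp (((c$i - c$j) * h) *\<^sub>R K22) ** block22 (jacobian g (at (x j))))))"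
proof -
  let ?S = "\<lambda>i j. (if i = j then mat 1 else 0)
     - (h * a$i$j) *\<^sub>R (mat_exp (((c$i - c$j) * h) *\<^sub>R block_diag K11 K22) ** jacobian g (at (x j)))"
  have inv': "invertible (block_matrix ?S)"
    using inv by (simp add: ssei_stage_matrix_eq_block_matrix)
  have S: "block11 (?S i j) = (if i = j then mat 1 else 0)
      - (h * a$i$j) *\<^sub>R (mat_exp (((c$i - c$j) * h) *\<^sub>R K11) ** block11 (jacobian g (at (x j))))"
    "block22 (?S i j) = (if i = j then mat 1 else 0)
      - (h * a$i$j) *\<^sub>R (mat_exp (((c$i - c$j) * h) *\<^sub>R K22) ** block22 (jacobian g (at (x j))))"
    "block12 (?S i j) = 0" for i j
    by (simp_all add: block_linear_simps blocks_of_mult blocks_of_mat_1 mat_exp_scaled_block_diag corner)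
  show "invertible (block_matrix (\<lambda>i j. (if i = j then mat 1 else 0)
      - (h * a$i$j) *\<^sub>R (mat_exp (((c$i - c$j) * h) *\<^sub>R K11) ** block11 (jacobian g (at (x j))))))"
    using invertible_diagonal_blocks(1)[of ?S, OF inv' S(3)] by (simp only: S)
  show "invertible (block_matrix (\<lambda>i j. (if i = j then mat 1 else 0)
      - (h * a$i$j) *\<^sub>R (mat_exp (((c$i - c$j) * h) *\<^sub>R K22) ** block22 (jacobian g (at (x j))))))"
    using invertible_diagonal_blocks(2)[of ?S, OF inv' S(3)] by (simp only: S)
qed

text \<open>The stage equations of the upper components form a closed system once \<open>y2\<close> is fixed.  For
  each \<open>y2\<close> they are solved by the upper stage components, so \<open>y2\<close> may select among several
  solutions, but each of them is admissible.\<close>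

lemma ssei_map_upper_part:
  fixes K11 :: "real^'m^'m" and K22 :: "real^'n^'n"
  assumes \<phi>: "ssei_map c b a h (block_diag K11 K22) g \<phi>"
    and g_diff: "\<And>y. g differentiable (at y)"
    and g: "\<And>y1 y2. g (stack y1 y2) = stack (g1 y1) (g2 y1 y2)"
  shows "ssei_map c b a h K11 g1 (\<lambda>y1. upper_part (\<phi> (stack y1 y2)))"
proof -
  let ?K = "block_diag K11 K22"
  obtain k where stages: "ssei_stages c a h ?K g k"
    and \<phi>_eq: "\<And>y. \<phi> y = mat_exp (h *\<^sub>R ?K) *v y
        + h *\<^sub>R (\<Sum>i\<in>UNIV. b$i *\<^sub>R (mat_exp (((1 - c$i) * h) *\<^sub>R ?K) *v g (k i y)))"
    using \<phi> unfolding ssei_map_def by auto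
  define k1 where "k1 i y1 = upper_part (k i (stack y1 y2))" for i y1
  have upper_g: "upper_part (g z) = g1 (upper_part z)" for z
    using g[of "upper_part z" "lower_part z"] by simp
  note upper_simps = linear_add[OF parts_linear(1)] linear_cmul[OF parts_linear(1)]
    linear_sum[OF parts_linear(1)] mat_exp_scaled_block_diag upper_part_block_diag_mult upper_g
  have "ssei_stages c a h K11 g1 k1"
    unfolding ssei_stages_def
  proof (intro conjI allI)
    fix i y1
    have "k i (stack y1 y2) = mat_exp ((c$i * h) *\<^sub>R ?K) *v stack y1 y2
        + h *\<^sub>R (\<Sum>j\<in>UNIV. a$i$j *\<^sub>R (mat_exp (((c$i - c$j) * h) *\<^sub>R ?K) *v g (k j (stack y1 y2))))"
      using stages unfolding ssei_stages_def by blast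
    then have "upper_part (k i (stack y1 y2)) = upper_part (mat_exp ((c$i * h) *\<^sub>R ?K) *v stack y1 y2
        + h *\<^sub>R (\<Sum>j\<in>UNIV. a$i$j *\<^sub>R (mat_exp (((c$i - c$j) * h) *\<^sub>R ?K) *v g (k j (stack y1 y2)))))"
      by (rule arg_cong)
    then show "k1 i y1 = mat_exp ((c$i * h) *\<^sub>R K11) *v y1
        + h *\<^sub>R (\<Sum>j\<in>UNIV. a$i$j *\<^sub>R (mat_exp (((c$i - c$j) * h) *\<^sub>R K11) *v g1 (k1 j y1)))"
      by (simp add: k1_def upper_simps)
  next
    fix i y1
    have "k i differentiable (at (stack y1 y2))"
      using stages unfolding ssei_stages_def by blast
    then show "k1 i differentiable (at y1)"
      unfolding k1_def[abs_def] by (rule differentiableI[OF partial_has_derivative(1)])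
  next
    fix y1
    have "invertible (ssei_stage_matrix c a h ?K g (\<lambda>i. k i (stack y1 y2)))"
      using stages unfolding ssei_stages_def by blast
    from invertible_stage_matrix_blocks(1)[OF this]
    show "invertible (ssei_stage_matrix c a h K11 g1 (\<lambda>i. k1 i y1))"
      by (simp add: ssei_stage_matrix_eq_block_matrix k1_def jacobian_blocks[OF g g_diff])
  qed
  moreover have "upper_part (\<phi> (stack y1 y2)) = mat_exp (h *\<^sub>R K11) *v y1
        + h *\<^sub>R (\<Sum>i\<in>UNIV. b$i *\<^sub>R (mat_exp (((1 - c$i) * h) *\<^sub>R K11) *v g1 (k1 i y1)))" for y1
    by (simp add: \<phi>_eq k1_def upper_simps)
  ultimately show ?thesis
    unfolding ssei_map_def by blast
qed

section \<open>Volume preservation\<close>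

theorem theorem4p6:
  fixes K11 :: "real^'m^'m" and g1 u :: "real^'m \<Rightarrow> real^'m"
    and K22 :: "real^'n^'n" and g2 v :: "real^'m \<Rightarrow> real^'n \<Rightarrow> real^'n"
    and K :: "real^('m + 'n)^('m + 'n)" and g f :: "real^('m + 'n) \<Rightarrow> real^('m + 'n)"
    and P :: "real^'n^'n"
    and c b :: "real^'s" and a :: "real^'s^'s" and h :: real
  assumes u: "\<And>y1. u y1 = K11 *v y1 + g1 y1"
    and v: "\<And>y1 y2. v y1 y2 = K22 *v y2 + g2 y1 y2"
    and K: "K = block_diag K11 K22"
    and g: "\<And>y1 y2. g (stack y1 y2) = stack (g1 y1) (g2 y1 y2)"
    and f: "\<And>y1 y2. f (stack y1 y2) = stack (u y1) (v y1 y2)"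
    and RK: "symplectic_RK b a" "\<And>j. b $ j \<noteq> 0"
    and u_appl: "ssei_applicable c b a h K11 g1"
    and u_vp: "ssei_volume_preserving c b a h K11 g1"
    and P: "invertible P"
    and Pv: "\<And>y1 y2. P ** jacobian (v y1) (at y2) ** matrix_inv P
                        = - transpose (jacobian (v y1) (at y2))"
    and Pg2: "\<And>y1 y2. P ** jacobian (g2 y1) (at y2) ** matrix_inv P
                        = - transpose (jacobian (g2 y1) (at y2))"
    and f_class: "f \<in> class_F_inf"
    and f_appl: "ssei_applicable c b a h K g"
  shows "ssei_volume_preserving c b a h K g"
  unfolding ssei_volume_preserving_def
proof (intro allI impI)
  fix \<phi> y
  assume \<phi>_map: "ssei_map c b a h K g \<phi>"
  then obtain k where stages: "ssei_stages c a h K g k"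
    and \<phi>: "\<And>y. \<phi> y = mat_exp (h *\<^sub>R K) *v y
        + h *\<^sub>R (\<Sum>i\<in>UNIV. b$i *\<^sub>R (mat_exp (((1 - c$i) * h) *\<^sub>R K) *v g (k i y)))"
    unfolding ssei_map_def by auto
  have g_diff: "\<And>y. g differentiable (at y)"
    using f_appl unfolding ssei_applicable_def by blast
  have k_diff: "\<And>i y. k i differentiable (at y)"
    using stages unfolding ssei_stages_def by blast

  define E where "E t = mat_exp ((t * h) *\<^sub>R K)" for t
  define E1 where "E1 t = mat_exp ((t * h) *\<^sub>R K11)" for t
  define E2 where "E2 t = mat_exp ((t * h) *\<^sub>R K22)" for t
  define J where "J i = jacobian g (at (k i y))" for i
  define X where "X i = jacobian (k i) (at y)" for i
  define \<Phi> where "\<Phi> = jacobian \<phi> (at y)"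
  have E: "E t = block_diag (E1 t) (E2 t)" for t
    by (simp add: E_def E1_def E2_def K block_diag_scaleR mat_exp_block_diag)

  note J_blocks = jacobian_blocks[OF g g_diff]
  have X_eq: "X i = E (c$i) + (\<Sum>j\<in>UNIV. (h * a$i$j) *\<^sub>R (E (c$i - c$j) ** J j ** X j))" for i
  proof -
    have "k i = (\<lambda>y. E (c$i) *v y + h *\<^sub>R (\<Sum>j\<in>UNIV. a$i$j *\<^sub>R (E (c$i - c$j) *v g (k j y))))"
      using stages unfolding ssei_stages_def E_def by blast
    moreover note jacobian_eqI[OF has_derivative_exponential_combination[where g = g and k = k and y = y, OF g_diff k_diff]]
    ultimately show ?thesis
      unfolding X_def J_def by metis
  qed
  have \<Phi>_eq: "\<Phi> = E 1 + (\<Sum>j\<in>UNIV. (h * b$j) *\<^sub>R (E (1 - c$j) ** J j ** X j))"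
    and \<phi>_diff: "\<phi> differentiable (at y)"
  proof -
    have \<phi>: "\<phi> = (\<lambda>y. E 1 *v y + h *\<^sub>R (\<Sum>j\<in>UNIV. b$j *\<^sub>R (E (1 - c$j) *v g (k j y))))"
      unfolding E_def using \<phi> by auto
    have D: "(\<phi> has_derivative (*v) (E 1 + (\<Sum>j\<in>UNIV. (h * b$j) *\<^sub>R (E (1 - c$j) ** J j ** X j)))) (at y)"
      unfolding \<phi> J_def X_def by (rule has_derivative_exponential_combination[OF g_diff k_diff])
    show "\<Phi> = E 1 + (\<Sum>j\<in>UNIV. (h * b$j) *\<^sub>R (E (1 - c$j) ** J j ** X j))"
      unfolding \<Phi>_def using D by (rule jacobian_eqI)
    show "\<phi> differentiable (at y)"
      using D by (rule differentiableI)
  qed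

  have "invertible (ssei_stage_matrix c a h K g (\<lambda>i. k i y))"
    using stages unfolding ssei_stages_def by blast
  note S_inv = invertible_stage_matrix_blocks[OF this[unfolded K] J_blocks(2), folded J_def E1_def E2_def]
  have J12: "block12 (J i) = 0" for i
    by (simp add: J_def J_blocks)
  note block_simps = E block_linear_simps blocks_of_mult J12

  \<comment> \<open>The derivatives of the upper stage components with respect to the lower variables solve a
    homogeneous system with an invertible matrix.\<close>
  have X12: "block12 (X i) = 0" for i
  proof -
    let ?S = "block_matrix (\<lambda>i j. (if i = j then mat 1 else 0)
        - (h * a$i$j) *\<^sub>R (E1 (c$i - c$j) ** block11 (J j)))"
    have "block12 (X i) = (\<Sum>j\<in>UNIV. (h * a$i$j) *\<^sub>R (E1 (c$i - c$j) ** block11 (J j) ** block12 (X j)))" for i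
      by (subst X_eq) (simp add: block_simps)
    then have "?S ** block_column (\<lambda>i. block12 (X i)) = 0"
      unfolding block_one_minus_mult_column by (simp add: matrix_mult_scaleR block_column_def vec_eq_iff)
    moreover obtain N where "N ** ?S = mat 1"
      using S_inv(1) unfolding invertible_def by blast
    ultimately have "block_column (\<lambda>i. block12 (X i)) = 0"
      using matrix_mul_assoc[of N ?S "block_column (\<lambda>i. block12 (X i))"] by simp
    then have "block_column (\<lambda>i. block12 (X i)) $ (i, p) = 0" for p
      by simp
    then show ?thesis
      by (simp add: block_column_def vec_eq_iff)
  qed
  have corner: "block12 \<Phi> = 0"
    by (simp add: \<Phi>_eq block_simps X12)

  have "det (block22 \<Phi>) = 1"
  proof -
    have skew_g2: "P ** jacobian (g2 y1) (at y2) = - (transpose (jacobian (g2 y1) (at y2)) ** P)" for y1 y2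
      by (rule skew_adjoint_of_similar[OF P Pg2])
    \<comment> \<open>\<open>K22\<close> is the difference of \<open>\<partial>v/\<partial>y2\<close> and \<open>\<partial>g2/\<partial>y2\<close> at any point, here at \<open>y\<close>.\<close>
    have skew_K22: "P ** K22 = - (transpose K22 ** P)"
    proof -
      let ?y1 = "upper_part y" and ?y2 = "lower_part y"
      have "(g2 ?y1 has_derivative (*v) (jacobian (g2 ?y1) (at ?y2))) (at ?y2)"
        using J_blocks(4)[of y] by (simp add: jacobian_works)
      then have "(v ?y1 has_derivative (\<lambda>w. K22 *v w + jacobian (g2 ?y1) (at ?y2) *v w)) (at ?y2)"
        unfolding v[abs_def] by (auto intro!: has_derivative_add bounded_linear_imp_has_derivative)
      then have "jacobian (v ?y1) (at ?y2) = K22 + jacobian (g2 ?y1) (at ?y2)"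
        by (intro jacobian_eqI) (simp add: matrix_vector_mult_add_rdistrib)
      then show ?thesis
        using skew_adjoint_of_similar[OF P Pv[of ?y1 ?y2]] skew_g2[of ?y1 ?y2]
        by (simp add: matrix_add_ldistrib matrix_add_rdistrib transpose_add)
    qed
    have X22: "block22 (X i) = E2 (c$i)
        + (\<Sum>j\<in>UNIV. (h * a$i$j) *\<^sub>R (E2 (c$i - c$j) ** block22 (J j) ** block22 (X j)))" for i
      by (subst X_eq) (simp add: block_simps X12)
    have "det (E2 1 + (\<Sum>j\<in>UNIV. (h * b$j) *\<^sub>R (E2 (1 - c$j) ** block22 (J j) ** block22 (X j)))) = 1"
    proof (rule det_symplectic_RK_eq_1[OF RK P _ _ _ _ _ X22])
      show "E2 (s + t) = E2 s ** E2 t" for s t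
        by (simp add: E2_def distrib_right mat_exp_scaleR_add)
      show "E2 0 = mat 1"
        by (simp add: E2_def mat_exp_0)
      show "transpose (E2 t) ** P ** E2 t = P" for t
        unfolding E2_def by (rule transpose_mat_exp_bilinear_form[OF skew_K22])
      show "P ** block22 (J i) = - (transpose (block22 (J i)) ** P)" for i
        unfolding J_def J_blocks by (rule skew_g2)
      show "det (block_matrix (\<lambda>i j. (if i = j then mat 1 else 0)
          - (h * a$i$j) *\<^sub>R (E2 (c$i - c$j) ** block22 (J j)))) \<noteq> 0"
        using S_inv(2) by (simp add: invertible_det_nz)
    qed
    then show ?thesis
      by (simp add: \<Phi>_eq block_simps X12)
  qed
  \<comment> \<open>The lower component of \<open>y\<close> is frozen, so that the derivative of the resulting map is the upper
    left block of \<open>\<Phi>\<close>.\<close>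
  moreover have "det (block11 \<Phi>) = 1"
  proof -
    let ?\<phi>1 = "\<lambda>y1. upper_part (\<phi> (stack y1 (lower_part y)))"
    have "ssei_map c b a h K11 g1 ?\<phi>1"
      using ssei_map_upper_part[OF _ g_diff g] \<phi>_map K by blast
    then have "det (jacobian ?\<phi>1 (at (upper_part y))) = 1"
      using u_vp unfolding ssei_volume_preserving_def by blast
    moreover have "jacobian ?\<phi>1 (at (upper_part y)) = block11 \<Phi>"
      using partial_has_derivative(1)[of \<phi> "upper_part y" "lower_part y"] \<phi>_diff
      unfolding \<Phi>_def by (intro jacobian_eqI) simp
    ultimately show ?thesis
      by simp
  qed
  moreover have "det \<Phi> = det (block11 \<Phi>) * det (block22 \<Phi>)"
    by (subst from_blocks_of_matrix[of \<Phi>]) (simp add: corner det_from_blocks_lower_triangular)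
  ultimately show "det (jacobian \<phi> (at y)) = 1"
    by (simp add: \<Phi>_def)
qed

end
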